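(* Let $G=(S,E)$ be a finite simple directed graph with at least one edge and with $|S|=2n$, $n>1$. The associated 2-step nilpotent Lie algebra $\mathfrak n_G$ is almost nonsingular if and only if $G$ has a vertex covering by $n$ disjoint copies of $K_2$.
   Context: Construction of $\mathfrak{n}_G$: let $G=(S,E)$ be a finite simple directed graph with at least one edge, with vertex set $S=\{X_1,\dots,X_m\}$ and edge set $E=\{Z_1,\dots,Z_q\}$. Let $\mathcal V$ be the real vector space with basis $S$, $\mathfrak z$ the real vector space with basis $E$, and $\mathfrak n_G=\mathcal V\oplus\mathfrak z$. The Lie bracket is the bilinear skew-symmetric extension of: $[X_i,X_l]=Z_k$ if $Z_k$ is a directed edge from $X_i$ to $X_l$; $[X_i,X_l]=0$ if $X_i,X_l$ are not adjacent; and $[\mathfrak n_G,\mathfrak z]=0$. The inner product is the one making $S\cup E$ orthonormal. For $Z\in\mathfrak z$, the skew-symmetric linear map $j(Z):\mathcal V\to\mathcal V$ is defined by $\langle j(Z)X,Y\rangle=\langle[X,Y],Z\rangle$ for $X,Y\in\mathcal V$. Throughout $\mathfrak z$ and $\mathcal V$ denote these spans of edges and of vertices (also when $G$ has isolated vertices). $\mathfrak n_G$ is almost nonsingular if $j(Z)$ is nonsingular (invertible) for every $Z$ in an open dense subset of $\mathfrak z$. Vertex covering: for $S=\{X_1,\dots,X_{2n}\}$, $G$ has a vertex covering by $n$ disjoint copies of $K_2$ if there is a permutation $\sigma$ of $\{1,\dots,2n\}$ such that for all $1\le i\le n$ the vertices $X_{\sigma(2i-1)}$ and $X_{\sigma(2i)}$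 are joined by an edge of $G$ (in either direction). *)

theory Defs
  imports
    "HOL-Analysis.Analysis"
    "HOL-Combinatorics.Permutations"
    "Graph_Theory.Digraph"
begin

(* A simple directed graph is an orientation of a simple undirected graph.  The locale
   digraph already excludes loops and parallel arcs but still allows a pair of opposite
   arcs u -> v, v -> u, for which the bracket [u, v] below would not be well defined. *)
locale simple_digraph = digraph +
  assumes no_opposite_arcs: "u \<rightarrow>\<^bsub>G\<^esub> v \<Longrightarrow> \<not> v \<rightarrow>\<^bsub>G\<^esub> u"

(* The vertices and arcs of G are drawn from finite types 'v and 'e, of which verts G and
   arcs G may be proper subsets.  A vertex v is identified with axis v 1 in real ^ 'v, an
   arc e with axis e 1 in real ^ 'e.  The Lie algebra is a subspace of the product
   (real ^ 'v) \<times> (real ^ 'e), whose standard inner product makes these basis vectors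
   orthonormal. *)
definition vert_space :: "('v::finite, 'e) pre_digraph \<Rightarrow> (real ^ 'v) set" where
  "vert_space G = span ((\<lambda>v. axis v 1) ` verts G)"

definition arc_space :: "('v, 'e::finite) pre_digraph \<Rightarrow> (real ^ 'e) set" where
  "arc_space G = span ((\<lambda>e. axis e 1) ` arcs G)"

definition lie_algebra ::
  "('v::finite, 'e::finite) pre_digraph \<Rightarrow> ((real ^ 'v) \<times> (real ^ 'e)) set" where
  "lie_algebra G = vert_space G \<times> arc_space G"

definition arc_between :: "('v, 'e) pre_digraph \<Rightarrow> 'v \<Rightarrow> 'v \<Rightarrow> 'e" where
  "arc_between G u v = (THE e. e \<in> arcs G \<and> tail G e = u \<and> head G e = v)"

definition vert_bracket :: "('v, 'e::finite) pre_digraph \<Rightarrow> 'v \<Rightarrow> 'v \<Rightarrow> real ^ 'e" where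
  "vert_bracket G u v =
     (if u \<rightarrow>\<^bsub>G\<^esub> v then axis (arc_between G u v) 1
      else if v \<rightarrow>\<^bsub>G\<^esub> u then - axis (arc_between G v u) 1
      else 0)"

(* Bilinear extension of the bracket of vertices; the arc components do not contribute
   because the arc space is central. *)
definition lie_bracket ::
  "('v::finite, 'e::finite) pre_digraph \<Rightarrow> (real ^ 'v) \<times> (real ^ 'e)
     \<Rightarrow> (real ^ 'v) \<times> (real ^ 'e) \<Rightarrow> (real ^ 'v) \<times> (real ^ 'e)" where
  "lie_bracket G X Y =
     (0, \<Sum>u\<in>verts G. \<Sum>v\<in>verts G. (fst X $ u * fst Y $ v) *\<^sub>R vert_bracket G u v)"

definition j_map ::
  "('v::finite, 'e::finite) pre_digraph \<Rightarrow> real ^ 'e \<Rightarrow> real ^ 'v \<Rightarrow> real ^ 'v" where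
  "j_map G Z X = (THE W. W \<in> vert_space G \<and>
     (\<forall>Y\<in>vert_space G. (W, 0) \<bullet> (Y, 0 :: real ^ 'e) = lie_bracket G (X, 0) (Y, 0) \<bullet> (0, Z)))"

definition almost_nonsingular :: "('v::finite, 'e::finite) pre_digraph \<Rightarrow> bool" where
  "almost_nonsingular G \<longleftrightarrow>
     (\<exists>U. openin (top_of_set (arc_space G)) U \<and> arc_space G \<subseteq> closure U \<and>
        (\<forall>Z\<in>U. bij_betw (j_map G Z) (vert_space G) (vert_space G)))"

(* The choice of the enumeration X of the vertices is immaterial: changing it only
   changes the permutation \<sigma>. *)
definition K2_covering :: "('v, 'e) pre_digraph \<Rightarrow> nat \<Rightarrow> bool" where
  "K2_covering G n \<longleftrightarrow>
     (\<exists>X \<sigma>. bij_betw X {1..2 * n} (verts G) \<and> \<sigma> permutes {1..2 * n} \<and>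
        (\<forall>i\<in>{1..n}. X (\<sigma> (2 * i - 1)) \<rightarrow>\<^bsub>G\<^esub> X (\<sigma> (2 * i)) \<or>
                    X (\<sigma> (2 * i)) \<rightarrow>\<^bsub>G\<^esub> X (\<sigma> (2 * i - 1))))"

lemma mem_vert_space: "x \<in> vert_space G \<longleftrightarrow> (\<forall>v. v \<notin> verts G \<longrightarrow> x $ v = 0)"
  for x :: "real ^ 'v"
proof
  assume "x \<in> vert_space G"
  then show "\<forall>v. v \<notin> verts G \<longrightarrow> x $ v = 0"
    unfolding vert_space_def
  proof (induction rule: span_induct_alt)
    case base
    show ?case by simp
  next
    case (step c y z)
    from step(1) obtain u where "u \<in> verts G" "y = axis u 1" by blast
    with step(2) show ?case by (auto simp: axis_def)
  qed
next
  assume *: "\<forall>v. v \<notin> verts G \<longrightarrow> x $ v = 0"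
  have "x = (\<Sum>v\<in>UNIV. x $ v *\<^sub>R axis v 1)"
    by (simp add: vec_eq_iff axis_def if_distrib cong: if_cong)
  also have "\<dots> \<in> vert_space G"
    unfolding vert_space_def
  proof (rule span_sum)
    fix v :: 'v
    show "x $ v *\<^sub>R axis v 1 \<in> span ((\<lambda>v. axis v (1::real)) ` verts G)"
      using * by (cases "v \<in> verts G") (auto intro: span_scale span_base span_zero)
  qed
  finally show "x \<in> vert_space G" .
qed

lemma j_map_unique:
  fixes G :: "('v::finite, 'e::finite) pre_digraph"
  shows "\<exists>!W. W \<in> vert_space G \<and>
    (\<forall>Y\<in>vert_space G. (W, 0) \<bullet> (Y, 0 :: real ^ 'e) = lie_bracket G (X, 0) (Y, 0) \<bullet> (0, Z))"
proof
  define W :: "real ^ 'v" where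
    "W = (\<chi> v. if v \<in> verts G then \<Sum>u\<in>verts G. X $ u * (vert_bracket G u v \<bullet> Z) else 0)"
  have "W \<bullet> Y = snd (lie_bracket G (X, 0) (Y, 0 :: real ^ 'e)) \<bullet> Z" for Y
  proof -
    have "W \<bullet> Y = (\<Sum>v\<in>verts G. W $ v * Y $ v)"
      unfolding inner_vec_def inner_real_def
      by (rule sum.mono_neutral_right) (auto simp: W_def)
    also have "\<dots> = (\<Sum>v\<in>verts G. \<Sum>u\<in>verts G. X $ u * Y $ v * (vert_bracket G u v \<bullet> Z))"
      by (simp add: W_def sum_distrib_left sum_distrib_right mult_ac)
    also have "\<dots> = (\<Sum>u\<in>verts G. \<Sum>v\<in>verts G. X $ u * Y $ v * (vert_bracket G u v \<bullet> Z))"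
      by (rule sum.swap)
    finally show ?thesis
      by (simp add: lie_bracket_def inner_sum_left)
  qed
  then show "W \<in> vert_space G \<and>
    (\<forall>Y\<in>vert_space G. (W, 0) \<bullet> (Y, 0 :: real ^ 'e) = lie_bracket G (X, 0) (Y, 0) \<bullet> (0, Z))"
    by (simp add: mem_vert_space W_def lie_bracket_def)
  fix W' assume W': "W' \<in> vert_space G \<and>
    (\<forall>Y\<in>vert_space G. (W', 0) \<bullet> (Y, 0 :: real ^ 'e) = lie_bracket G (X, 0) (Y, 0) \<bullet> (0, Z))"
  have W: "W \<in> vert_space G" "\<And>Y. W \<bullet> Y = snd (lie_bracket G (X, 0) (Y, 0 :: real ^ 'e)) \<bullet> Z"
    by (simp add: mem_vert_space W_def) fact
  have "W' - W \<in> vert_space G"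
    using W' W(1) by (simp add: mem_vert_space)
  then have "(W' - W) \<bullet> (W' - W) = 0"
    using W' W(2) by (simp add: inner_diff_left lie_bracket_def)
  then show "W' = W" by simp
qed

lemma lie_bracket_skew: "lie_bracket G Y X = - lie_bracket G X Y" if "simple_digraph G"
proof -
  interpret simple_digraph G by fact
  have skew: "vert_bracket G v u = - vert_bracket G u v" for u v
    using no_opposite_arcs by (auto simp: vert_bracket_def)
  have "(\<Sum>u\<in>verts G. \<Sum>v\<in>verts G. (fst Y $ u * fst X $ v) *\<^sub>R vert_bracket G u v) =
        (\<Sum>v\<in>verts G. \<Sum>u\<in>verts G. (fst Y $ u * fst X $ v) *\<^sub>R - vert_bracket G v u)"
    by (subst sum.swap) (simp only: skew[symmetric])
  then show ?thesis
    by (simp add: lie_bracket_def sum_negf mult.commute)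
qed

lemma lie_bracket_in_lie_algebra: "lie_bracket G X Y \<in> lie_algebra G" if "simple_digraph G"
proof -
  interpret simple_digraph G by fact
  have arc: "arc_between G u v \<in> arcs G" if uv: "u \<rightarrow>\<^bsub>G\<^esub> v" for u v
  proof -
    obtain e where e: "e \<in> arcs G" "tail G e = u" "head G e = v"
      using uv by (rule reachableE)
    then have "arc_between G u v = e"
      unfolding arc_between_def
      by (intro the_equality conjI) (simp_all add: no_multi_arcs arc_to_ends_def)
    with e show ?thesis by simp
  qed
  have "vert_bracket G u v \<in> arc_space G" for u v
    using arc by (auto simp: vert_bracket_def arc_space_def intro: span_base span_zero intro!: span_neg)
  then show ?thesis
    by (auto simp: lie_bracket_def lie_algebra_def vert_space_def arc_space_def
        intro!: span_sum span_scale span_zero)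
qed

end

theory Submission
  imports Defs
begin

text \<open>
  In the basis of vertices the map \<open>j(Z)\<close> is a skew-symmetric matrix whose entries are the
  coordinates of \<open>Z\<close> up to sign, with a nonzero entry possible only at adjacent vertices.
  Its determinant is therefore a polynomial in \<open>Z\<close>, and a polynomial is nonzero on an open dense
  set as soon as it is nonzero somewhere. Hence almost nonsingularity means that \<^emph>\<open>some\<close>
  \<open>Z\<close> makes \<open>j(Z)\<close> invertible (\<open>almost_nonsingular_iff_some_nonsingular\<close>).

  Given a covering, let \<open>Z\<close> be the sum of the arcs used in it. Then every row of
  \<open>j(Z)\<close> has exactly one nonzero entry, in the column of the partner, so \<open>j(Z)\<close> is invertible
  (\<open>pairing_imp_nonsingular\<close>).

  For the converse, a nonsingular skew matrix always has a perfect pairing in its support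
  (\<open>skew_nonsingular_imp_pairing\<close>). This is Tutte's observation that the Pfaffian is a signed
  sum over pairings, but Pfaffians are avoided here. Pick a nonzero entry at \<open>u, v\<close>. As a
  function of that entry alone the Pfaffian is affine, and its slope is, up to sign, the Pfaffian of
  the matrix with \<open>u, v\<close> removed. So either that smaller matrix is nonsingular, and a pairing
  of it extends by \<open>u, v\<close>, or the entry can be set to zero without making the matrix singular,
  and there is less support left to search. The dichotomy is
  \<open>nonsingular_delete_edge_or_ends\<close>, which is proved by comparing kernel vectors.
\<close>

section \<open>Skew matrices and pairings\<close>

text \<open>
  Matrices are functions with an explicit index set, rather than of type \<open>real ^ 'v ^ 'v\<close>,
  because the induction below shrinks the index set.
\<close>

definition nonsingular_on :: "'a set \<Rightarrow> ('a \<Rightarrow> 'a \<Rightarrow> real) \<Rightarrow> bool" where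
  "nonsingular_on S A \<longleftrightarrow>
     (\<forall>x. (\<forall>w\<in>S. (\<Sum>z\<in>S. A w z * x z) = 0) \<longrightarrow> (\<forall>z\<in>S. x z = 0))"

text \<open>
  A perfect matching, given by listing the partners next to each other as positions
  \<open>2 * i - 1\<close> and \<open>2 * i\<close>.
\<close>

definition pairing :: "('a \<Rightarrow> 'a \<Rightarrow> bool) \<Rightarrow> 'a set \<Rightarrow> nat \<Rightarrow> (nat \<Rightarrow> 'a) \<Rightarrow> bool" where
  "pairing R S n Y \<longleftrightarrow>
     bij_betw Y {1..2 * n} S \<and> (\<forall>i\<in>{1..n}. R (Y (2 * i - 1)) (Y (2 * i)))"

lemma pairing_mono:
  "pairing R S n Y \<Longrightarrow> (\<And>u v. u \<in> S \<Longrightarrow> v \<in> S \<Longrightarrow> R u v \<Longrightarrow> R' u v) \<Longrightarrow> pairing R' S n Y"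
  unfolding pairing_def
proof (elim conjE, intro conjI ballI)
  fix i assume bij: "bij_betw Y {1..2 * n} S"
    and R: "\<forall>i\<in>{1..n}. R (Y (2 * i - 1)) (Y (2 * i))"
    and imp: "\<And>u v. u \<in> S \<Longrightarrow> v \<in> S \<Longrightarrow> R u v \<Longrightarrow> R' u v" and i: "i \<in> {1..n}"
  have "2 * i - 1 \<in> {1..2 * n}" "2 * i \<in> {1..2 * n}" using i by auto
  then have "Y (2 * i - 1) \<in> S" "Y (2 * i) \<in> S" using bij by (auto simp: bij_betw_def)
  then show "R' (Y (2 * i - 1)) (Y (2 * i))" using R i imp by blast
qed

lemma pairing_insert_pair:
  assumes "pairing R S n Y" "u \<notin> S" "v \<notin> S" "u \<noteq> v" "R u v"
  shows "pairing R (insert u (insert v S)) (Suc n) (Y(2 * n + 1 := u, 2 * n + 2 := v))"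
proof -
  let ?Y = "Y(2 * n + 1 := u, 2 * n + 2 := v)"
  have bij: "bij_betw Y {1..2 * n} S" using assms(1) by (simp add: pairing_def)
  have "bij_betw ?Y {1..2 * n} S"
    using bij by (subst bij_betw_cong[where g = Y]) auto
  moreover have "bij_betw ?Y {2 * n + 1, 2 * n + 2} {u, v}"
    using assms(4) by (auto simp: bij_betw_def)
  moreover have "S \<inter> {u, v} = {}" using assms by auto
  ultimately have "bij_betw ?Y ({1..2 * n} \<union> {2 * n + 1, 2 * n + 2}) (S \<union> {u, v})"
    by (rule bij_betw_combine)
  moreover have "{1..2 * n} \<union> {2 * n + 1, 2 * n + 2} = {1..2 * Suc n}" by auto
  moreover have "S \<union> {u, v} = insert u (insert v S)" by auto
  ultimately have "bij_betw ?Y {1..2 * Suc n} (insert u (insert v S))" by simp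
  moreover have "R (?Y (2 * i - 1)) (?Y (2 * i))" if i: "i \<in> {1..Suc n}" for i
  proof (cases "i = Suc n")
    case True
    then show ?thesis using assms(5) by simp
  next
    case False
    then have "i \<in> {1..n}" using i by auto
    then have "?Y (2 * i - 1) = Y (2 * i - 1)" "?Y (2 * i) = Y (2 * i)" by auto
    with \<open>i \<in> {1..n}\<close> show ?thesis using assms(1) by (simp add: pairing_def)
  qed
  ultimately show ?thesis unfolding pairing_def by blast
qed

lemma skew_form_swap:
  fixes A :: "'a \<Rightarrow> 'a \<Rightarrow> real"
  assumes skew: "\<And>u v. A u v = - A v u"
  shows "(\<Sum>w\<in>S. (\<Sum>z\<in>S. A w z * x z) * y w) = - (\<Sum>w\<in>S. (\<Sum>z\<in>S. A w z * y z) * x w)"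
proof -
  have "(\<Sum>w\<in>S. (\<Sum>z\<in>S. A w z * x z) * y w) = (\<Sum>w\<in>S. \<Sum>z\<in>S. A w z * x z * y w)"
    by (simp add: sum_distrib_right)
  also have "\<dots> = (\<Sum>z\<in>S. \<Sum>w\<in>S. A w z * x z * y w)" by (rule sum.swap)
  also have "\<dots> = (\<Sum>z\<in>S. \<Sum>w\<in>S. - (A z w * y w * x z))"
    by (intro sum.cong refl) (subst skew, simp)
  also have "\<dots> = - (\<Sum>w\<in>S. (\<Sum>z\<in>S. A w z * y z) * x w)"
    by (simp add: sum_negf sum_distrib_right)
  finally show ?thesis .
qed

text \<open>
  Suppose that both smaller matrices are singular. A kernel vector \<open>x\<close> of the matrix with the
  entry deleted satisfies \<open>A x = a (x v e\<^sub>u - x u e\<^sub>v)\<close>, where \<open>a = A u v\<close>. A kernel vector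
  \<open>y\<close> of the matrix with \<open>u, v\<close> removed, extended by zero, has \<open>A y\<close> supported on
  \<open>{u, v}\<close> as well. By skewness the inner product of \<open>A y\<close> with \<open>x\<close> is minus that of \<open>A x\<close> with \<open>y\<close>,
  which is zero since the supports are disjoint; in the plane of \<open>e\<^sub>u, e\<^sub>v\<close> this forces \<open>A y\<close> to be
  a multiple of \<open>A x\<close>. As \<open>A\<close> is nonsingular, \<open>y\<close> is a nonzero multiple of \<open>x\<close>, so \<open>x\<close>
  vanishes at \<open>u\<close> and \<open>v\<close>, and then \<open>A x = 0\<close>, which is impossible.
\<close>

lemma nonsingular_delete_edge_or_ends:
  fixes A :: "'a \<Rightarrow> 'a \<Rightarrow> real"
  assumes fin: "finite S" and skew: "\<And>u v. A u v = - A v u"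
    and ns: "nonsingular_on S A" and uS: "u \<in> S" and vS: "v \<in> S" and uv: "u \<noteq> v"
  shows "nonsingular_on S (\<lambda>w z. if {w, z} = {u, v} then 0 else A w z) \<or>
         nonsingular_on (S - {u, v}) A"
proof (rule ccontr)
  let ?B = "\<lambda>w z. if {w, z} = {u, v} then 0 else A w z"
  define a where "a = A u v"
  assume "\<not> ?thesis"
  then have nB: "\<not> nonsingular_on S ?B" and nC: "\<not> nonsingular_on (S - {u, v}) A" by auto
  from nB obtain x where x: "\<forall>w\<in>S. (\<Sum>z\<in>S. ?B w z * x z) = 0" and "\<exists>z\<in>S. x z \<noteq> 0"
    unfolding nonsingular_on_def by blast
  from nC obtain y0 where y0: "\<forall>w\<in>S - {u, v}. (\<Sum>z\<in>S - {u, v}. A w z * y0 z) = 0"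
    and y0n: "\<exists>z\<in>S - {u, v}. y0 z \<noteq> 0"
    unfolding nonsingular_on_def by blast
  define y where "y z = (if z \<in> {u, v} then 0 else y0 z)" for z
  define P where "P w = (\<Sum>z\<in>S. A w z * x z)" for w
  define Q where "Q w = (\<Sum>z\<in>S. A w z * y z)" for w
  have Av: "A v u = - a" using skew[of v u] by (simp add: a_def)
  have P: "P w = (if w = u then a * x v else if w = v then - a * x u else 0)" if "w \<in> S" for w
  proof -
    have "P w = P w - (\<Sum>z\<in>S. ?B w z * x z)" using x that by simp
    also have "\<dots> = (\<Sum>z\<in>S. (A w z - ?B w z) * x z)"
      by (simp add: P_def sum_subtractf left_diff_distrib)
    also have "\<dots> = (\<Sum>z\<in>S. (if z = v then (if w = u then a * x v else 0) else 0)
                       + (if z = u then (if w = v then - a * x u else 0) else 0))"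
      using uv Av by (intro sum.cong refl) (auto simp: a_def doubleton_eq_iff)
    also have "\<dots> = (if w = u then a * x v else if w = v then - a * x u else 0)"
      using fin uS vS uv by (simp add: sum.distrib)
    finally show ?thesis .
  qed
  have Q: "Q w = 0" if "w \<in> S" "w \<noteq> u" "w \<noteq> v" for w
  proof -
    have "Q w = (\<Sum>z\<in>S - {u, v}. A w z * y0 z)"
      unfolding Q_def using fin by (intro sum.mono_neutral_cong_right) (auto simp: y_def)
    then show ?thesis using y0 that by simp
  qed
  have two: "(\<Sum>w\<in>S. f w) = f u + f v" if "\<And>w. w \<in> S \<Longrightarrow> w \<noteq> u \<Longrightarrow> w \<noteq> v \<Longrightarrow> f w = 0"
    for f :: "'a \<Rightarrow> real"
  proof -
    have "(\<Sum>w\<in>S. f w) = (\<Sum>w\<in>{u, v}. f w)"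
      using fin uS vS that by (intro sum.mono_neutral_right) auto
    then show ?thesis using uv by simp
  qed
  have "(\<Sum>w\<in>S. P w * y w) = - (\<Sum>w\<in>S. Q w * x w)"
    unfolding P_def Q_def by (rule skew_form_swap[OF skew])
  moreover have "(\<Sum>w\<in>S. P w * y w) = 0"
    using P by (intro sum.neutral) (auto simp: y_def)
  moreover have "(\<Sum>w\<in>S. Q w * x w) = Q u * x u + Q v * x v"
    using Q by (intro two) simp
  ultimately have orth: "Q u * x u + Q v * x v = 0" by simp
  have xuv: "a * x u \<noteq> 0 \<or> a * x v \<noteq> 0"
  proof (rule ccontr)
    assume "\<not> ?thesis"
    then have "\<forall>w\<in>S. P w = 0" using P by auto
    then have "\<forall>z\<in>S. x z = 0" using ns unfolding nonsingular_on_def P_def by blast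
    then show False using \<open>\<exists>z\<in>S. x z \<noteq> 0\<close> by blast
  qed
  (* (Q u, Q v) is orthogonal to (x u, x v), hence proportional to (x v, - x u). *)
  obtain c where c: "Q u = c * (a * x v)" "Q v = - c * (a * x u)"
  proof (cases "x v = 0")
    case True
    with xuv orth have "Q u = 0" "a * x u \<noteq> 0" by auto
    with True show ?thesis by (intro that[of "- Q v / (a * x u)"]) auto
  next
    case False
    have "a \<noteq> 0" using xuv by auto
    have "Q v = - (Q u * x u) / x v" using orth False by (simp add: field_simps)
    with False \<open>a \<noteq> 0\<close> show ?thesis by (intro that[of "Q u / (a * x v)"]) auto
  qed
  have "(\<Sum>z\<in>S. A w z * (y z - c * x z)) = 0" if "w \<in> S" for w
  proof -
    have "(\<Sum>z\<in>S. A w z * (y z - c * x z)) = Q w - c * P w"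
      by (simp add: Q_def P_def sum_subtractf right_diff_distrib sum_distrib_left mult.left_commute)
    also have "\<dots> = 0" using P[OF that] Q[OF that] c by auto
    finally show ?thesis .
  qed
  then have "\<forall>z\<in>S. y z - c * x z = 0"
    using ns[unfolded nonsingular_on_def, rule_format, of "\<lambda>z. y z - c * x z"] by blast
  then have yx: "y z = c * x z" if "z \<in> S" for z using that by auto
  from y0n obtain z where "z \<in> S" "z \<notin> {u, v}" "y0 z \<noteq> 0" by blast
  then have "z \<in> S" "y z \<noteq> 0" by (simp_all add: y_def)
  then have "c \<noteq> 0" using yx by auto
  moreover have "c * x u = 0" "c * x v = 0" using yx[OF uS] yx[OF vS] by (auto simp: y_def)
  ultimately show False using xuv by auto
qed

text \<open>
  Each branch of the dichotomy loses nonzero entries, so induction on their number works. When none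
  is left, the all-ones vector is in the kernel, hence the index set is empty.
\<close>

lemma skew_nonsingular_imp_pairing:
  fixes A :: "'a \<Rightarrow> 'a \<Rightarrow> real"
  assumes "finite S" "\<And>u v. A u v = - A v u" "nonsingular_on S A"
  shows "\<exists>n Y. pairing (\<lambda>u v. A u v \<noteq> 0) S n Y"
  using assms
proof (induction "card {(u, v) \<in> S \<times> S. A u v \<noteq> 0}" arbitrary: S A rule: less_induct)
  case less
  note fin = less.prems(1) and skew = less.prems(2) and ns = less.prems(3)
  have finE: "finite {(u, v) \<in> S \<times> S. A u v \<noteq> 0}"
    by (rule finite_subset[of _ "S \<times> S"]) (use fin in auto)
  show ?case
  proof (cases "\<exists>u\<in>S. \<exists>v\<in>S. A u v \<noteq> 0")
    case False
    then have "\<forall>z\<in>S. (1::real) = 0"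
      using ns[unfolded nonsingular_on_def, rule_format, of "\<lambda>_. 1"] by auto
    then have "pairing (\<lambda>u v. A u v \<noteq> 0) S 0 Y" for Y
      by (auto simp: pairing_def bij_betw_def)
    then show ?thesis by blast
  next
    case True
    then obtain u v where uv: "u \<in> S" "v \<in> S" "A u v \<noteq> 0" by blast
    have "u \<noteq> v" using uv(3) skew[of u u] by auto
    let ?B = "\<lambda>w z. if {w, z} = {u, v} then 0 else A w z"
    from nonsingular_delete_edge_or_ends[OF fin skew ns uv(1,2) \<open>u \<noteq> v\<close>]
    show ?thesis
    proof
      assume nsB: "nonsingular_on S ?B"
      have "card {(w, z) \<in> S \<times> S. ?B w z \<noteq> 0} < card {(w, z) \<in> S \<times> S. A w z \<noteq> 0}"
        by (rule psubset_card_mono[OF finE]) (use uv in \<open>auto split: if_splits\<close>)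
      moreover have "?B w z = - ?B z w" for w z
        using skew[of w z] by (simp add: insert_commute)
      ultimately obtain n Y where "pairing (\<lambda>w z. ?B w z \<noteq> 0) S n Y"
        using less.hyps[of S ?B] fin nsB by blast
      then have "pairing (\<lambda>w z. A w z \<noteq> 0) S n Y"
        by (rule pairing_mono) (auto split: if_splits)
      then show ?thesis by blast
    next
      assume nsC: "nonsingular_on (S - {u, v}) A"
      have "card {(w, z) \<in> (S - {u, v}) \<times> (S - {u, v}). A w z \<noteq> 0}
              < card {(w, z) \<in> S \<times> S. A w z \<noteq> 0}"
        by (rule psubset_card_mono[OF finE]) (use uv in auto)
      then obtain n Y where "pairing (\<lambda>w z. A w z \<noteq> 0) (S - {u, v}) n Y"
        using less.hyps[of "S - {u, v}" A] fin skew nsC by blast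
      then have "pairing (\<lambda>w z. A w z \<noteq> 0) (insert u (insert v (S - {u, v}))) (Suc n)
                   (Y(2 * n + 1 := u, 2 * n + 2 := v))"
        by (rule pairing_insert_pair) (use uv \<open>u \<noteq> v\<close> in auto)
      moreover have "insert u (insert v (S - {u, v})) = S" using uv by auto
      ultimately show ?thesis by metis
    qed
  qed
qed

text \<open>
  If the support is exactly the pairing, the row of the partner of \<open>z\<close> involves only the
  unknown \<open>x z\<close>, so the kernel equation of that row gives \<open>x z = 0\<close>.
\<close>

lemma pairing_imp_nonsingular:
  fixes A :: "'a \<Rightarrow> 'a \<Rightarrow> real"
  assumes fin: "finite S" and Y: "pairing R S n Y"
    and A: "\<And>u v. u \<in> S \<Longrightarrow> v \<in> S \<Longrightarrow>
      A u v \<noteq> 0 \<longleftrightarrow> (\<exists>i\<in>{1..n}. {u, v} = {Y (2 * i - 1), Y (2 * i)})"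
  shows "nonsingular_on S A"
  unfolding nonsingular_on_def
proof (intro allI impI ballI)
  fix x z assume x: "\<forall>w\<in>S. (\<Sum>z\<in>S. A w z * x z) = 0" and z: "z \<in> S"
  have bij: "bij_betw Y {1..2 * n} S" using Y by (simp add: pairing_def)
  then have inj: "inj_on Y {1..2 * n}" and img: "Y ` {1..2 * n} = S" by (auto simp: bij_betw_def)
  from z img obtain k where k: "k \<in> {1..2 * n}" "z = Y k" by blast
  define i where "i = (k + 1) div 2"
  have i: "i \<in> {1..n}" and ki: "k = 2 * i \<or> k = 2 * i - 1" using k(1) by (auto simp: i_def)
  (* l is the position of the partner of z in the list Y. *)
  define l where "l = (if k = 2 * i then 2 * i - 1 else 2 * i)"
  have l: "l \<in> {1..2 * n}" using i by (auto simp: l_def)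
  then have w: "Y l \<in> S" using img by blast
  have row: "A (Y l) z' \<noteq> 0 \<longleftrightarrow> z' = z" if z': "z' \<in> S" for z'
  proof
    assume "A (Y l) z' \<noteq> 0"
    then obtain j where j: "j \<in> {1..n}" "{Y l, z'} = {Y (2 * j - 1), Y (2 * j)}"
      using A[OF w z'] by blast
    have jj: "2 * j - 1 \<in> {1..2 * n}" "2 * j \<in> {1..2 * n}" using j(1) by auto
    from j(2) consider "Y l = Y (2 * j - 1)" "z' = Y (2 * j)" | "Y l = Y (2 * j)" "z' = Y (2 * j - 1)"
      by (auto simp: doubleton_eq_iff)
    then show "z' = z"
    proof cases
      case 1
      then have "l = 2 * j - 1" using inj_onD[OF inj _ l jj(1)] by simp
      then have "2 * j = k" using i j(1) ki by (auto simp: l_def split: if_splits; presburger)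
      then show ?thesis using 1 k by simp
    next
      case 2
      then have "l = 2 * j" using inj_onD[OF inj _ l jj(2)] by simp
      then have "2 * j - 1 = k" using i j(1) ki by (auto simp: l_def split: if_splits; presburger)
      then show ?thesis using 2 k by simp
    qed
  next
    assume "z' = z"
    have "{Y l, z} = {Y (2 * i - 1), Y (2 * i)}" using k ki i by (auto simp: l_def)
    then show "A (Y l) z' \<noteq> 0" using A[OF w z] i \<open>z' = z\<close> by blast
  qed
  have "0 = (\<Sum>z'\<in>S. A (Y l) z' * x z')" using x w by simp
  also have "\<dots> = (\<Sum>z'\<in>{z}. A (Y l) z' * x z')"
    using row z fin by (intro sum.mono_neutral_right) auto
  finally show "x z = 0" using row[OF z] by simp
qed

section \<open>The matrix of the map j\<close>

text \<open>
  The first index is the row: the coefficient of \<open>v\<close> in \<open>j(Z) u\<close> is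
  \<open>\<langle>j(Z) u, v\<rangle> = \<langle>[u, v], Z\<rangle>\<close>.
\<close>

definition j_entry :: "('v::finite, 'e::finite) pre_digraph \<Rightarrow> real ^ 'e \<Rightarrow> 'v \<Rightarrow> 'v \<Rightarrow> real" where
  "j_entry G Z v u = vert_bracket G u v \<bullet> Z"

lemma j_map_nth:
  "j_map G Z X $ v = (if v \<in> verts G then \<Sum>u\<in>verts G. j_entry G Z v u * X $ u else 0)"
proof -
  let ?P = "\<lambda>W. W \<in> vert_space G \<and> (\<forall>Y\<in>vert_space G.
     (W, 0) \<bullet> (Y, 0 :: real ^ 'b) = lie_bracket G (X, 0) (Y, 0) \<bullet> (0, Z))"
  have W: "?P (j_map G Z X)"
    unfolding j_map_def by (rule theI'[OF j_map_unique])
  show ?thesis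
  proof (cases "v \<in> verts G")
    case False
    then show ?thesis using W by (simp add: mem_vert_space)
  next
    case True
    then have "axis v 1 \<in> vert_space G" by (auto simp: mem_vert_space axis_def)
    then have "j_map G Z X \<bullet> axis v 1 = snd (lie_bracket G (X, 0) (axis v 1, 0 :: real ^ 'b)) \<bullet> Z"
      using W by (auto simp: lie_bracket_def)
    also have "\<dots> = (\<Sum>u\<in>verts G. \<Sum>w\<in>verts G. if w = v then j_entry G Z v u * X $ u else 0)"
      unfolding lie_bracket_def snd_conv fst_conv inner_sum_left
      by (intro sum.cong refl) (simp add: j_entry_def axis_def)
    also have "\<dots> = (\<Sum>u\<in>verts G. j_entry G Z v u * X $ u)"
      using True by simp
    finally show ?thesis using True by (simp add: inner_axis)
  qed
qed

lemma j_map_bij_iff_nonsingular: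
  "bij_betw (j_map G Z) (vert_space G) (vert_space G) \<longleftrightarrow> nonsingular_on (verts G) (j_entry G Z)"
proof -
  have lin: "linear (j_map G Z)"
    by (rule linearI)
       (auto simp: vec_eq_iff j_map_nth sum.distrib distrib_left sum_distrib_left mult.left_commute)
  have sub: "subspace (vert_space G)" by (simp add: vert_space_def)
  have into: "j_map G Z ` vert_space G \<subseteq> vert_space G" by (auto simp: mem_vert_space j_map_nth)
  have inj: "inj_on (j_map G Z) (vert_space G) \<longleftrightarrow> (\<forall>x\<in>vert_space G. j_map G Z x = 0 \<longrightarrow> x = 0)"
    using linear_inj_on_iff_eq_0[OF lin sub] by blast
  have "bij_betw (j_map G Z) (vert_space G) (vert_space G) \<longleftrightarrow> inj_on (j_map G Z) (vert_space G)"
  proof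
    assume i: "inj_on (j_map G Z) (vert_space G)"
    have "j_map G Z ` vert_space G = vert_space G"
    proof (rule subspace_dim_equal[OF _ sub into])
      show "subspace (j_map G Z ` vert_space G)" using lin sub by (rule linear_subspace_image)
      show "dim (vert_space G) \<le> dim (j_map G Z ` vert_space G)"
        using dim_image_eq[OF lin, of "vert_space G"] i sub by (simp add: span_eq_iff[THEN iffD2])
    qed
    with i show "bij_betw (j_map G Z) (vert_space G) (vert_space G)" by (simp add: bij_betw_def)
  qed (simp add: bij_betw_def)
  also have "\<dots> \<longleftrightarrow> nonsingular_on (verts G) (j_entry G Z)"
    unfolding inj
  proof
    assume *: "\<forall>x\<in>vert_space G. j_map G Z x = 0 \<longrightarrow> x = 0"
    show "nonsingular_on (verts G) (j_entry G Z)"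
      unfolding nonsingular_on_def
    proof (intro allI impI ballI)
      fix x z assume x: "\<forall>w\<in>verts G. (\<Sum>z\<in>verts G. j_entry G Z w z * x z) = 0" and z: "z \<in> verts G"
      define X :: "real ^ 'a" where "X = (\<chi> v. if v \<in> verts G then x v else 0)"
      have "X \<in> vert_space G" by (auto simp: X_def mem_vert_space)
      moreover have "j_map G Z X = 0" using x by (auto simp: vec_eq_iff j_map_nth X_def)
      ultimately have "X = 0" using * by blast
      then have "X $ z = 0" by simp
      then show "x z = 0" using z by (simp add: X_def)
    qed
  next
    assume ns: "nonsingular_on (verts G) (j_entry G Z)"
    show "\<forall>x\<in>vert_space G. j_map G Z x = 0 \<longrightarrow> x = 0"
    proof (intro ballI impI)
      fix x assume x: "x \<in> vert_space G" "j_map G Z x = 0"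
      have "\<forall>w\<in>verts G. (\<Sum>z\<in>verts G. j_entry G Z w z * x $ z) = 0"
      proof
        fix w assume "w \<in> verts G"
        then show "(\<Sum>z\<in>verts G. j_entry G Z w z * x $ z) = 0"
          using arg_cong[OF x(2), of "\<lambda>W. W $ w"] by (simp add: j_map_nth)
      qed
      then have "\<forall>z\<in>verts G. x $ z = 0"
        using ns[unfolded nonsingular_on_def, rule_format, of "\<lambda>z. x $ z"] by blast
      then show "x = 0" using x(1) by (auto simp: vec_eq_iff mem_vert_space)
    qed
  qed
  finally show ?thesis .
qed

section \<open>Openness and density\<close>

text \<open>
  The determinant is available for matrices indexed by a whole type, so the matrix on \<open>S\<close> is
  completed by an identity block outside \<open>S\<close>, which leaves the determinant unchanged.
\<close>

definition pad_matrix :: "'v::finite set \<Rightarrow> ('v \<Rightarrow> 'v \<Rightarrow> real) \<Rightarrow> real ^ 'v ^ 'v" where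
  "pad_matrix S A = (\<chi> i j. if i \<in> S \<and> j \<in> S then A i j else if i = j then 1 else 0)"

lemma nonsingular_on_iff_det:
  fixes S :: "'v::finite set"
  shows "nonsingular_on S A \<longleftrightarrow> det (pad_matrix S A) \<noteq> 0"
proof -
  have mv: "(pad_matrix S A *v x) $ i = (if i \<in> S then \<Sum>j\<in>S. A i j * x $ j else x $ i)" for x i
  proof (cases "i \<in> S")
    case True
    then have "(pad_matrix S A *v x) $ i = (\<Sum>j\<in>UNIV. if j \<in> S then A i j * x $ j else 0)"
      by (auto simp: matrix_vector_mult_def pad_matrix_def intro!: sum.cong)
    then show ?thesis using True by (simp add: sum.If_cases)
  next
    case False
    then show ?thesis
      by (simp add: matrix_vector_mult_def pad_matrix_def if_distrib[where f = "\<lambda>c. c * _"] cong: if_cong)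
  qed
  have "det (pad_matrix S A) \<noteq> 0 \<longleftrightarrow> (\<forall>x. pad_matrix S A *v x = 0 \<longrightarrow> x = 0)"
    by (simp add: invertible_det_nz[symmetric] invertible_left_inverse matrix_left_invertible_ker)
  also have "\<dots> \<longleftrightarrow> nonsingular_on S A"
  proof
    assume *: "\<forall>x. pad_matrix S A *v x = 0 \<longrightarrow> x = 0"
    show "nonsingular_on S A"
      unfolding nonsingular_on_def
    proof (intro allI impI ballI)
      fix x z assume x: "\<forall>w\<in>S. (\<Sum>z\<in>S. A w z * x z) = 0" and z: "z \<in> S"
      let ?X = "\<chi> v. if v \<in> S then x v else 0"
      have "pad_matrix S A *v ?X = 0" using x by (auto simp: vec_eq_iff mv)
      then have "?X $ z = 0" using * by (metis zero_index)
      then show "x z = 0" using z by simp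
    qed
  next
    assume ns: "nonsingular_on S A"
    show "\<forall>x. pad_matrix S A *v x = 0 \<longrightarrow> x = 0"
    proof (intro allI impI)
      fix x assume x: "pad_matrix S A *v x = 0"
      have eq: "(if i \<in> S then \<Sum>j\<in>S. A i j * x $ j else x $ i) = 0" for i
        using x mv[of x i] by simp
      have "\<forall>i\<in>S. (\<Sum>j\<in>S. A i j * x $ j) = 0"
      proof
        fix i assume "i \<in> S"
        then show "(\<Sum>j\<in>S. A i j * x $ j) = 0" using eq[of i] by simp
      qed
      then have "\<forall>z\<in>S. x $ z = 0"
        using ns[unfolded nonsingular_on_def, rule_format, of "\<lambda>z. x $ z"] by blast
      moreover have "x $ i = 0" if "i \<notin> S" for i using eq[of i] that by simp
      ultimately show "x = 0" by (auto simp: vec_eq_iff)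
    qed
  qed
  finally show ?thesis by simp
qed

text \<open>
  By the Leibniz formula the determinant along the line is the real polynomial \<open>q\<close>, which is
  not the zero polynomial because it does not vanish at \<open>s\<close>.
\<close>

lemma det_affine_line_finite_zeros:
  fixes M :: "real \<Rightarrow> real ^ 'v ^ 'v"
  assumes M: "\<And>t i j. M t $ i $ j = a i j + t * b i j" and nz: "det (M s) \<noteq> 0"
  shows "finite {t. det (M t) = 0}"
proof -
  define q where "q = (\<Sum>p\<in>{p. p permutes (UNIV :: 'v set)}.
    [:of_int (sign p):] * (\<Prod>i\<in>UNIV. [:a i (p i), b i (p i):]))"
  have q: "poly q t = det (M t)" for t
    by (simp add: q_def det_def poly_sum poly_prod M mult.commute)
  then have "q \<noteq> 0" using nz by (metis poly_0)
  from poly_roots_finite[OF this] show ?thesis by (simp add: q)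
qed

text \<open>
  Openness is continuity of the determinant. For density, join an arbitrary \<open>Z\<close> to the given
  nonsingular \<open>Z0\<close> by a line; the determinant does not vanish at \<open>Z0\<close>, so it has finitely many
  zeros on the line, and there are nonsingular points on it arbitrarily close to \<open>Z\<close>.
\<close>

lemma almost_nonsingular_iff_some_nonsingular:
  fixes G :: "('v::finite, 'e::finite) pre_digraph"
  shows "almost_nonsingular G \<longleftrightarrow> (\<exists>Z\<in>arc_space G. nonsingular_on (verts G) (j_entry G Z))"
proof
  assume "almost_nonsingular G"
  then obtain U where U: "openin (top_of_set (arc_space G)) U" "arc_space G \<subseteq> closure U"
    "\<forall>Z\<in>U. nonsingular_on (verts G) (j_entry G Z)"
    unfolding almost_nonsingular_def j_map_bij_iff_nonsingular by blast
  have "0 \<in> arc_space G" by (simp add: arc_space_def span_zero)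
  then have "U \<noteq> {}" using U(2) by auto
  moreover have "U \<subseteq> arc_space G" using openin_subset[OF U(1)] by simp
  ultimately show "\<exists>Z\<in>arc_space G. nonsingular_on (verts G) (j_entry G Z)" using U(3) by blast
next
  define D where "D Z = det (pad_matrix (verts G) (j_entry G Z))" for Z
  assume "\<exists>Z\<in>arc_space G. nonsingular_on (verts G) (j_entry G Z)"
  then obtain Z0 where Z0: "Z0 \<in> arc_space G" "D Z0 \<noteq> 0"
    by (auto simp: D_def nonsingular_on_iff_det)
  let ?U = "arc_space G \<inter> {Z. D Z \<noteq> 0}"
  have cont: "continuous_on UNIV (\<lambda>Z. pad_matrix (verts G) (j_entry G Z) $ i $ j)" for i j
    by (cases "i \<in> verts G \<and> j \<in> verts G")
       (auto simp: pad_matrix_def j_entry_def intro!: continuous_intros)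
  have "continuous_on UNIV D"
    unfolding D_def det_def by (intro continuous_intros cont)
  then have "open {Z. D Z \<noteq> 0}"
    by (intro open_Collect_neq) auto
  then have "openin (top_of_set (arc_space G)) ?U" by (simp add: openin_open_Int)
  moreover have "arc_space G \<subseteq> closure ?U"
  proof
    fix Z assume Z: "Z \<in> arc_space G"
    have "\<exists>Z'\<in>?U. dist Z' Z < e" if e: "e > 0" for e
    proof -
      let ?L = "\<lambda>t. Z + t *\<^sub>R (Z0 - Z)"
      have fin: "finite {t. D (?L t) = 0}"
        unfolding D_def
      proof (rule det_affine_line_finite_zeros)
        fix t i j
        show "pad_matrix (verts G) (j_entry G (?L t)) $ i $ j =
            pad_matrix (verts G) (j_entry G Z) $ i $ j +
            t * (if i \<in> verts G \<and> j \<in> verts G then j_entry G (Z0 - Z) i j else 0)"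
          by (simp add: pad_matrix_def j_entry_def inner_add_right)
        show "det (pad_matrix (verts G) (j_entry G (?L 1))) \<noteq> 0"
          using Z0(2) by (simp add: D_def)
      qed
      (* The added 1 keeps the denominator positive when Z = Z0. *)
      define d where "d = e / (norm (Z0 - Z) + 1)"
      have np: "norm (Z0 - Z) + 1 > 0" by (rule add_nonneg_pos) auto
      have "d > 0" using e np by (simp add: d_def)
      then have "infinite {0<..<d}" by simp
      then have "{0<..<d} - {t. D (?L t) = 0} \<noteq> {}"
        using fin by (metis Diff_eq_empty_iff finite_subset)
      then obtain t where "t \<in> {0<..<d} - {t. D (?L t) = 0}" by (meson ex_in_conv)
      then have t: "0 < t" "t < d" "D (?L t) \<noteq> 0" by simp_all
      have "?L t \<in> arc_space G"
        using Z Z0(1) unfolding arc_space_def by (intro span_add span_scale span_diff)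
      moreover have "dist (?L t) Z < e"
      proof -
        have "dist (?L t) Z = t * norm (Z0 - Z)" using t(1) by (simp add: dist_norm)
        also have "\<dots> \<le> t * (norm (Z0 - Z) + 1)" using t(1) by simp
        also have "\<dots> < d * (norm (Z0 - Z) + 1)" using t(2) np by (rule mult_strict_right_mono)
        also have "\<dots> = e" using np by (simp add: d_def)
        finally show ?thesis .
      qed
      ultimately show ?thesis using t(3) by blast
    qed
    then show "Z \<in> closure ?U" by (simp add: closure_approachable)
  qed
  moreover have "\<forall>Z\<in>?U. bij_betw (j_map G Z) (vert_space G) (vert_space G)"
    by (auto simp: j_map_bij_iff_nonsingular nonsingular_on_iff_det D_def)
  ultimately show "almost_nonsingular G" unfolding almost_nonsingular_def by blast
qed

section \<open>Coverings by edges\<close>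

lemma K2_covering_iff_pairing:
  "K2_covering G n \<longleftrightarrow> (\<exists>Y. pairing (\<lambda>u v. u \<rightarrow>\<^bsub>G\<^esub> v \<or> v \<rightarrow>\<^bsub>G\<^esub> u) (verts G) n Y)"
proof
  assume "K2_covering G n"
  then obtain X \<sigma> where X: "bij_betw X {1..2 * n} (verts G)" "\<sigma> permutes {1..2 * n}"
    "\<forall>i\<in>{1..n}. X (\<sigma> (2 * i - 1)) \<rightarrow>\<^bsub>G\<^esub> X (\<sigma> (2 * i)) \<or> X (\<sigma> (2 * i)) \<rightarrow>\<^bsub>G\<^esub> X (\<sigma> (2 * i - 1))"
    unfolding K2_covering_def by blast
  then have "pairing (\<lambda>u v. u \<rightarrow>\<^bsub>G\<^esub> v \<or> v \<rightarrow>\<^bsub>G\<^esub> u) (verts G) n (X \<circ> \<sigma>)"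
    using bij_betw_trans[OF permutes_imp_bij[OF X(2)] X(1)] by (simp add: pairing_def)
  then show "\<exists>Y. pairing (\<lambda>u v. u \<rightarrow>\<^bsub>G\<^esub> v \<or> v \<rightarrow>\<^bsub>G\<^esub> u) (verts G) n Y" by blast
next
  assume "\<exists>Y. pairing (\<lambda>u v. u \<rightarrow>\<^bsub>G\<^esub> v \<or> v \<rightarrow>\<^bsub>G\<^esub> u) (verts G) n Y"
  then obtain Y where "pairing (\<lambda>u v. u \<rightarrow>\<^bsub>G\<^esub> v \<or> v \<rightarrow>\<^bsub>G\<^esub> u) (verts G) n Y" by blast
  then show "K2_covering G n"
    unfolding K2_covering_def pairing_def
    by (intro exI[of _ Y] exI[of _ id]) (simp add: permutes_id)
qed

lemma j_entry_skew:
  assumes "simple_digraph G"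
  shows "j_entry G Z u v = - j_entry G Z v u"
proof -
  interpret simple_digraph G by fact
  show ?thesis using no_opposite_arcs by (auto simp: j_entry_def vert_bracket_def)
qed

lemma j_entry_nz_imp_adjacent: "j_entry G Z u v \<noteq> 0 \<Longrightarrow> u \<rightarrow>\<^bsub>G\<^esub> v \<or> v \<rightarrow>\<^bsub>G\<^esub> u"
  by (auto simp: j_entry_def vert_bracket_def split: if_splits)

lemma arc_spaceI:
  fixes Z :: "real ^ 'e"
  assumes *: "\<And>e. e \<notin> arcs G \<Longrightarrow> Z $ e = 0"
  shows "Z \<in> arc_space G"
proof -
  have "Z = (\<Sum>e\<in>UNIV. Z $ e *\<^sub>R axis e 1)"
    by (simp add: vec_eq_iff axis_def if_distrib cong: if_cong)
  also have "\<dots> \<in> arc_space G"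
    unfolding arc_space_def
  proof (rule span_sum)
    fix e :: 'e
    show "Z $ e *\<^sub>R axis e 1 \<in> span ((\<lambda>e. axis e (1::real)) ` arcs G)"
      using *[of e] by (cases "e \<in> arcs G") (auto intro: span_scale span_base span_zero)
  qed
  finally show ?thesis .
qed

text \<open>
  The vector is the sum of the arcs that join partners. Since opposite and parallel arcs are excluded,
  each pair contributes exactly one arc, so no cancellation can occur in the entries.
\<close>

lemma pairing_imp_nonsingular_arc_vector:
  fixes G :: "('v::finite, 'e::finite) pre_digraph"
  assumes "simple_digraph G" and Y: "pairing (\<lambda>u v. u \<rightarrow>\<^bsub>G\<^esub> v \<or> v \<rightarrow>\<^bsub>G\<^esub> u) (verts G) n Y"
  shows "\<exists>Z\<in>arc_space G. nonsingular_on (verts G) (j_entry G Z)"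
proof -
  interpret simple_digraph G by fact
  define M where "M = (\<lambda>i. {Y (2 * i - 1), Y (2 * i)}) ` {1..n}"
  define Z :: "real ^ 'e" where
    "Z = (\<chi> e. if e \<in> arcs G \<and> {tail G e, head G e} \<in> M then 1 else 0)"
  have arc: "Z $ arc_between G u v = (if {u, v} \<in> M then 1 else 0)" if uv: "u \<rightarrow>\<^bsub>G\<^esub> v" for u v
  proof -
    obtain e where e: "e \<in> arcs G" "tail G e = u" "head G e = v"
      using uv by (rule reachableE)
    then have "arc_between G u v = e"
      unfolding arc_between_def
      by (intro the_equality conjI) (simp_all add: no_multi_arcs arc_to_ends_def)
    with e show ?thesis by (simp add: Z_def)
  qed
  have adj: "u \<rightarrow>\<^bsub>G\<^esub> v \<or> v \<rightarrow>\<^bsub>G\<^esub> u" if "{u, v} \<in> M" for u v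
    using that Y by (fastforce simp: M_def pairing_def doubleton_eq_iff)
  have "j_entry G Z u v \<noteq> 0 \<longleftrightarrow> {u, v} \<in> M" for u v
    using adj[of u v] arc[of u v] arc[of v u] no_opposite_arcs[of u v]
    by (auto simp: j_entry_def vert_bracket_def inner_axis' insert_commute)
  then have "nonsingular_on (verts G) (j_entry G Z)"
    by (intro pairing_imp_nonsingular[OF _ Y]) (auto simp: M_def)
  moreover have "Z \<in> arc_space G" by (rule arc_spaceI) (simp add: Z_def)
  ultimately show ?thesis by blast
qed

theorem proposition3p9:
  fixes G :: "('v::finite, 'e::finite) pre_digraph" and n :: nat
  assumes "simple_digraph G"
    and "arcs G \<noteq> {}"
    and "card (verts G) = 2 * n"
    and "n > 1"
  shows "almost_nonsingular G \<longleftrightarrow> K2_covering G n"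
  unfolding almost_nonsingular_iff_some_nonsingular K2_covering_iff_pairing
proof
  assume "\<exists>Z\<in>arc_space G. nonsingular_on (verts G) (j_entry G Z)"
  then obtain Z where "nonsingular_on (verts G) (j_entry G Z)" by blast
  then obtain m Y where "pairing (\<lambda>u v. j_entry G Z u v \<noteq> 0) (verts G) m Y"
    using skew_nonsingular_imp_pairing[where A = "j_entry G Z", OF finite j_entry_skew[OF assms(1)]]
    by blast
  then have Y: "pairing (\<lambda>u v. u \<rightarrow>\<^bsub>G\<^esub> v \<or> v \<rightarrow>\<^bsub>G\<^esub> u) (verts G) m Y"
    by (rule pairing_mono) (rule j_entry_nz_imp_adjacent)
  then have "m = n"
    using bij_betw_same_card[of Y "{1..2 * m}" "verts G"] assms(3) by (simp add: pairing_def)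
  with Y show "\<exists>Y. pairing (\<lambda>u v. u \<rightarrow>\<^bsub>G\<^esub> v \<or> v \<rightarrow>\<^bsub>G\<^esub> u) (verts G) n Y" by blast
next
  assume "\<exists>Y. pairing (\<lambda>u v. u \<rightarrow>\<^bsub>G\<^esub> v \<or> v \<rightarrow>\<^bsub>G\<^esub> u) (verts G) n Y"
  then show "\<exists>Z\<in>arc_space G. nonsingular_on (verts G) (j_entry G Z)"
    using pairing_imp_nonsingular_arc_vector[OF assms(1)] by blast
qed

end
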